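(* Let $(\Omega,\mathsf F,\mathbb P)$ be a probability space and let $(X,d)$ be a complete and separable metric space with a fixed point $o\in X$. Let $X_0\subseteq X$ be compact, let $D$ be such that $d(z,o)\le D$ for all $z\in X_0$, and let $\emptyset\ne F=\bigcap_{k\in\mathbb N}AF_k$ for a sequence $(AF_k)$ of measurable sets with $AF_{k+1}\subseteq AF_k\subseteq X_0$ for all $k\in\mathbb N$, such that $F$ is explicitly closed w.r.t. $(AF_k)$. Let $G:[0,\infty)\to[0,\infty)$ be strictly increasing, continuous and coercive (i.e. $\lim_{t\to+\infty}G(t)=+\infty$) with $G(0)=0$. Let $(x_n)$ be a sequence of $X$-valued random variables which is stochastically quasi-Fejér monotone w.r.t. $F$ and a filtration $\mathcal F=(\mathcal F_n)$ of $\mathsf F$ (with this function $G$), and which has the stochastic $\liminf$-property w.r.t. $F$ and $(AF_k)$. Assume that $G(d(x_0,o)+D)$ has finite mean. Then there is a random variable $x$ such that $x_n\to x$ almost surely, where $x\in F$ almost surely.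
   Context: $X$ carries its Borel $\sigma$-algebra. $\ell^1_+(\mathcal F)$ is the set of sequences of nonnegative random variables adapted to $\mathcal F$ whose sum is almost surely finite. $\overline B_r(p)$ is the closed ball of radius $r$ around $p$. Explicit closedness of $F$ w.r.t. $(AF_k)$: for every $p\in X$, if $AF_M\cap\overline B_{1/(N+1)}(p)\neq\emptyset$ for all $N,M\in\mathbb N$, then $p\in F$. Stochastic quasi-Fejér monotonicity of $(x_n)$ w.r.t. $F$ and $\mathcal F$ (with $G$): $(x_n)$ is adapted to $\mathcal F$ and there are $(\eta_n),(\chi_n)\in\ell^1_+(\mathcal F)$ such that for all $n\in\mathbb N$ and $z\in F$, $\mathbb E[G(d(x_{n+1},z))\mid\mathcal F_n]\le(1+\chi_n)G(d(x_n,z))+\eta_n$ almost surely. Stochastic $\liminf$-property of $(x_n)$ w.r.t. $F$ and $(AF_k)$: almost surely, for all $k,N\in\mathbb N$ there exists $n\ge N$ with $x_n\in AF_k$. *)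

theory Defs
  imports "HOL-Probability.Probability"
begin

definition filtration_of :: "'w measure \<Rightarrow> (nat \<Rightarrow> 'w measure) \<Rightarrow> bool" where
  "filtration_of M \<F> \<longleftrightarrow> (\<forall>n. subalgebra M (\<F> n)) \<and> filtration (space M) \<F>"

definition adapted_to ::
  "(nat \<Rightarrow> 'w measure) \<Rightarrow> (nat \<Rightarrow> 'w \<Rightarrow> 'b::topological_space) \<Rightarrow> bool" where
  "adapted_to \<F> x \<longleftrightarrow> (\<forall>n. x n \<in> borel_measurable (\<F> n))"

definition l1_plus :: "'w measure \<Rightarrow> (nat \<Rightarrow> 'w measure) \<Rightarrow> (nat \<Rightarrow> 'w \<Rightarrow> real) set" where
  "l1_plus M \<F> = {\<eta>. adapted_to \<F> \<eta> \<and> (\<forall>n. \<forall>\<omega>\<in>space M. 0 \<le> \<eta> n \<omega>) \<and>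
     (AE \<omega> in M. summable (\<lambda>n. \<eta> n \<omega>))}"

definition explicitly_closed :: "'a::metric_space set \<Rightarrow> (nat \<Rightarrow> 'a set) \<Rightarrow> bool" where
  "explicitly_closed F AF \<longleftrightarrow>
     (\<forall>p. (\<forall>N M. AF M \<inter> cball p (1 / (real N + 1)) \<noteq> {}) \<longrightarrow> p \<in> F)"

text \<open>
  The random variables \<open>G (d (x\<^sub>n\<^sub>+\<^sub>1, z))\<close> are nonnegative but need not be integrable
  (\<open>\<gamma>\<^sub>n\<close> below may be unbounded), so their conditional expectation is the one for nonnegative
  random variables, with values in \<open>[0, \<infinity>]\<close>: \<^const>\<open>nn_cond_exp\<close>, and not
  \<^const>\<open>real_cond_exp\<close>, which maps infinite values to \<open>0\<close>.
\<close>

definition stoch_quasi_Fejer ::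
  "'w measure \<Rightarrow> (nat \<Rightarrow> 'w measure) \<Rightarrow> (real \<Rightarrow> real) \<Rightarrow> 'a::metric_space set
     \<Rightarrow> (nat \<Rightarrow> 'w \<Rightarrow> 'a) \<Rightarrow> bool" where
  "stoch_quasi_Fejer M \<F> G F x \<longleftrightarrow>
     adapted_to \<F> x \<and>
     (\<exists>\<eta>\<in>l1_plus M \<F>. \<exists>\<gamma>\<in>l1_plus M \<F>. \<forall>n. \<forall>z\<in>F. AE \<omega> in M.
        nn_cond_exp M (\<F> n) (\<lambda>\<omega>. ennreal (G (dist (x (Suc n) \<omega>) z))) \<omega>
          \<le> ennreal ((1 + \<gamma> n \<omega>) * G (dist (x n \<omega>) z) + \<eta> n \<omega>))"

text \<open>The set \<open>F\<close> enters the following property only through its approximations \<open>AF\<^sub>k\<close>.\<close>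

definition stoch_liminf_property ::
  "'w measure \<Rightarrow> (nat \<Rightarrow> 'a set) \<Rightarrow> (nat \<Rightarrow> 'w \<Rightarrow> 'a) \<Rightarrow> bool" where
  "stoch_liminf_property M AF x \<longleftrightarrow> (AE \<omega> in M. \<forall>k N. \<exists>n\<ge>N. x n \<omega> \<in> AF k)"

end

theory Submission
  imports Defs
begin

text \<open>
  Fix \<open>z \<in> F\<close>. The quasi-Fejer inequality makes \<open>G (d (x\<^sub>n, z))\<close> an almost supermartingale, so it
  converges almost surely (\<open>Robbins_Siegmund\<close>); a strictly increasing, continuous and coercive \<open>G\<close>
  reflects convergence, so the distances \<open>d (x\<^sub>n, z)\<close> converge almost surely. One null set serves for
  all \<open>z\<close> in a countable dense subset of \<open>F\<close>. The rest is deterministic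
  (\<open>tendsto_member_if_distances_converge\<close>): along almost every path the iterates visit every \<open>AF\<^sub>k\<close>,
  so compactness of \<open>X\<^sub>0\<close> gives a cluster point \<open>p\<close>, explicit closedness puts \<open>p\<close> into \<open>F\<close>, and
  since the distances to points of \<open>F\<close> near \<open>p\<close> converge, with small limits because of the
  subsequence tending to \<open>p\<close>, the whole path tends to \<open>p\<close>.

  The theorem of Robbins and Siegmund is reduced to Doob's convergence theorem for nonnegative
  supermartingales. The latter is proved without counting upcrossings. Let \<open>E\<close> be the event that the
  supermartingale is infinitely often at most \<open>a\<close> and infinitely often at least \<open>b\<close>, where \<open>a < b\<close>.
  After a visit below \<open>a\<close>, the maximal inequality gives probability at most \<open>a / b\<close> to a later
  visit above \<open>b\<close>. Every path in \<open>E\<close> makes such a pair of visits after any given time, and the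
  process can be restarted at the end of the second visit, so a bound
  \<open>P (A \<inter> E) \<le> (a / b)\<^sup>k P A\<close> for all \<open>n\<close> and all \<open>A \<in> \<F>\<^sub>n\<close> improves itself to the exponent
  \<open>k + 1\<close>, and \<open>E\<close> is null.
\<close>

section \<open>Nonnegative supermartingales\<close>

text \<open>
  The supermartingale property is expressed by integrals over events of the past. This is the form
  in which it enters the maximal inequality, and it makes sense for values in \<open>[0, \<infinity>]\<close>.
\<close>

locale nonneg_supermartingale = prob_space M for M :: "'w measure" +
  fixes \<F> :: "nat \<Rightarrow> 'w measure" and W :: "nat \<Rightarrow> 'w \<Rightarrow> ennreal"
  assumes filtration: "filtration_of M \<F>"
    and adapted: "\<And>n. W n \<in> borel_measurable (\<F> n)"
    and set_integral_decreasing: "\<And>n A. A \<in> sets (\<F> n) \<Longrightarrow>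
      (\<integral>\<^sup>+\<omega>\<in>A. W (Suc n) \<omega> \<partial>M) \<le> (\<integral>\<^sup>+\<omega>\<in>A. W n \<omega> \<partial>M)"
begin

lemma space_filtration [simp]: "space (\<F> n) = space M"
  using filtration by (auto simp: filtration_of_def subalgebra_def)

lemma sets_filtration_mono: "m \<le> n \<Longrightarrow> A \<in> sets (\<F> m) \<Longrightarrow> A \<in> sets (\<F> n)"
  using filtration by (auto simp: filtration_of_def filtration_def)

lemma sets_filtration_in_sets: "A \<in> sets (\<F> n) \<Longrightarrow> A \<in> sets M"
  using filtration by (auto simp: filtration_of_def subalgebra_def)

lemma W_measurable [measurable]: "W n \<in> borel_measurable M"
  using filtration by (intro measurable_from_subalg[OF _ adapted]) (simp add: filtration_of_def)

text \<open>
  Ville's inequality, localised to an event of the past. The induction splits \<open>A\<close> according to whether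
  the level \<open>b\<close> is reached at time \<open>n\<close>: there the right-hand side pays directly, and elsewhere the
  induction hypothesis applies from time \<open>n + 1\<close> on, after which the supermartingale property leads
  back to time \<open>n\<close>.
\<close>

lemma maximal_inequality_finite:
  assumes "A \<in> sets (\<F> n)"
  shows "b * emeasure M (A \<inter> (\<Union>m\<in>{n..n+h}. {\<omega>\<in>space M. b \<le> W m \<omega>}))
    \<le> (\<integral>\<^sup>+\<omega>\<in>A. W n \<omega> \<partial>M)"
  using assms
proof (induction h arbitrary: n A)
  case 0
  have [measurable]: "A \<in> sets M"
    using 0 sets_filtration_in_sets by auto
  have "b * emeasure M (A \<inter> {\<omega>\<in>space M. b \<le> W n \<omega>})
      = (\<integral>\<^sup>+\<omega>. b * indicator (A \<inter> {\<omega>\<in>space M. b \<le> W n \<omega>}) \<omega> \<partial>M)"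
    by (subst nn_integral_cmult_indicator) auto
  also have "\<dots> \<le> (\<integral>\<^sup>+\<omega>\<in>A. W n \<omega> \<partial>M)"
    by (intro nn_integral_mono) (auto simp: indicator_def)
  finally show ?case by simp
next
  case (Suc h)
  define B where "B = {\<omega>\<in>space M. b \<le> W n \<omega>}"
  define H where "H n h = (\<Union>m\<in>{n..n+h}. {\<omega>\<in>space M. b \<le> W m \<omega>})" for n h
  have [measurable]: "A \<in> sets (\<F> n)" "A \<in> sets M" "W n \<in> borel_measurable (\<F> n)"
    using Suc.prems sets_filtration_in_sets adapted by auto
  have B: "B \<in> sets (\<F> n)"
    unfolding B_def space_filtration[of n, symmetric] by measurable
  then have [measurable]: "B \<in> sets M" by (rule sets_filtration_in_sets)
  have [measurable]: "H n h \<in> sets M" for n h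
    unfolding H_def by measurable
  have AB: "A - B \<in> sets (\<F> n)" using B by auto
  have split: "A \<inter> H n (Suc h) = (A \<inter> B) \<union> ((A - B) \<inter> H (Suc n) h)"
  proof -
    have "{n..n + Suc h} = insert n {Suc n..Suc n + h}" by auto
    then have "H n (Suc h) = B \<union> H (Suc n) h"
      unfolding H_def B_def by simp
    then show ?thesis by auto
  qed
  have "b * emeasure M (A \<inter> H n (Suc h))
      \<le> b * (emeasure M (A \<inter> B) + emeasure M ((A - B) \<inter> H (Suc n) h))"
    unfolding split by (intro mult_left_mono emeasure_subadditive) auto
  also have "\<dots> = b * emeasure M (A \<inter> B) + b * emeasure M ((A - B) \<inter> H (Suc n) h)"
    by (simp add: distrib_left)
  also have "b * emeasure M (A \<inter> B) \<le> (\<integral>\<^sup>+\<omega>\<in>A \<inter> B. W n \<omega> \<partial>M)"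
  proof -
    have "b * emeasure M (A \<inter> B) = (\<integral>\<^sup>+\<omega>. b * indicator (A \<inter> B) \<omega> \<partial>M)"
      by (subst nn_integral_cmult_indicator) auto
    also have "\<dots> \<le> (\<integral>\<^sup>+\<omega>\<in>A \<inter> B. W n \<omega> \<partial>M)"
      by (intro nn_integral_mono) (auto simp: indicator_def B_def)
    finally show ?thesis .
  qed
  also have "b * emeasure M ((A - B) \<inter> H (Suc n) h) \<le> (\<integral>\<^sup>+\<omega>\<in>A - B. W n \<omega> \<partial>M)"
  proof -
    have "b * emeasure M ((A - B) \<inter> H (Suc n) h) \<le> (\<integral>\<^sup>+\<omega>\<in>A - B. W (Suc n) \<omega> \<partial>M)"
      unfolding H_def using AB by (intro Suc.IH sets_filtration_mono[of n "Suc n"]) auto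
    also have "\<dots> \<le> (\<integral>\<^sup>+\<omega>\<in>A - B. W n \<omega> \<partial>M)"
      using AB by (rule set_integral_decreasing)
    finally show ?thesis .
  qed
  also have "(\<integral>\<^sup>+\<omega>\<in>A \<inter> B. W n \<omega> \<partial>M) + (\<integral>\<^sup>+\<omega>\<in>A - B. W n \<omega> \<partial>M) = (\<integral>\<^sup>+\<omega>\<in>A. W n \<omega> \<partial>M)"
    by (subst nn_integral_add[symmetric])
       (auto intro!: nn_integral_cong simp: indicator_def)
  finally show ?case
    unfolding H_def by (simp add: add_mono)
qed

lemma maximal_inequality:
  assumes "A \<in> sets (\<F> n)"
  shows "b * emeasure M (A \<inter> (\<Union>m\<in>{n..}. {\<omega>\<in>space M. b \<le> W m \<omega>}))
    \<le> (\<integral>\<^sup>+\<omega>\<in>A. W n \<omega> \<partial>M)"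
proof -
  define H where "H h = A \<inter> (\<Union>m\<in>{n..n+h}. {\<omega>\<in>space M. b \<le> W m \<omega>})" for h
  have [measurable]: "A \<in> sets M" using assms sets_filtration_in_sets by auto
  have "{n..} = (\<Union>h. {n..n+h})"
  proof (intro equalityI subsetI)
    fix m assume "m \<in> {n..}"
    then have "m \<in> {n..n+m}" by simp
    then show "m \<in> (\<Union>h. {n..n+h})" by (rule UN_I[OF UNIV_I])
  qed auto
  then have "A \<inter> (\<Union>m\<in>{n..}. {\<omega>\<in>space M. b \<le> W m \<omega>}) = (\<Union>h. H h)"
    unfolding H_def by blast
  moreover have "(SUP h. emeasure M (H h)) = emeasure M (\<Union>h. H h)"
    by (rule SUP_emeasure_incseq) (auto simp: H_def incseq_def, force)
  ultimately have "b * emeasure M (A \<inter> (\<Union>m\<in>{n..}. {\<omega>\<in>space M. b \<le> W m \<omega>}))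
      = (SUP h. b * emeasure M (H h))"
    by (simp flip: SUP_mult_left_ennreal)
  also have "\<dots> \<le> (\<integral>\<^sup>+\<omega>\<in>A. W n \<omega> \<partial>M)"
    unfolding H_def by (intro SUP_least maximal_inequality_finite assms)
  finally show ?thesis .
qed

text \<open>
  This replaces the optional stopping argument. If every path in \<open>E\<close> enters the sets \<open>B\<^sub>m\<close> at some
  time \<open>m \<ge> n\<close>, a bound which holds from the time of a visit can be summed over the disjoint
  events that the first visit happens at time \<open>m\<close>.
\<close>

lemma first_passage_bound:
  assumes A: "A \<in> sets (\<F> n)" and B: "\<And>m. B m \<in> sets (\<F> m)"
    and E: "E \<in> sets M" "E \<subseteq> (\<Union>m\<in>{n..}. B m)"
    and bound: "\<And>m C. C \<in> sets (\<F> m) \<Longrightarrow> C \<subseteq> B m \<Longrightarrow>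
      c * emeasure M (C \<inter> E) \<le> d * emeasure M C"
  shows "c * emeasure M (A \<inter> E) \<le> d * emeasure M (A \<inter> (\<Union>m\<in>{n..}. B m))"
proof -
  define T where "T = disjointed (\<lambda>i. B (n + i))"
  define C where "C i = A \<inter> T i" for i
  have C_sets: "C i \<in> sets (\<F> (n + i))" for i
    unfolding C_def T_def disjointed_def
    by (intro sets.Int sets.Diff sets.finite_UN sets_filtration_mono[OF _ A] B
        sets_filtration_mono[OF _ B]) auto
  have C_sets_M: "C i \<in> sets M" for i
    using C_sets sets_filtration_in_sets by blast
  have C_sub: "C i \<subseteq> B (n + i)" for i
    using disjointed_subset[of "\<lambda>i. B (n + i)" i] unfolding C_def T_def by blast
  have disj: "disjoint_family C"
    using disjoint_family_disjointed[of "\<lambda>i. B (n + i)", folded T_def]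
    unfolding C_def by (auto simp: disjoint_family_on_def)
  have "(\<Union>i. T i) = (\<Union>i. B (n + i))" unfolding T_def by (rule UN_disjointed_eq)
  also have "\<dots> = (\<Union>m\<in>{n..}. B m)"
    using le_add1 by (fastforce simp: le_iff_add)
  finally have UN_C: "(\<Union>i. C i) = A \<inter> (\<Union>m\<in>{n..}. B m)"
    unfolding C_def by auto
  have "A \<inter> E = (\<Union>i. C i \<inter> E)"
    using E(2) UN_C by blast
  then have "c * emeasure M (A \<inter> E) = c * (\<Sum>i. emeasure M (C i \<inter> E))"
    using disj C_sets_M E(1)
    by (subst suminf_emeasure) (auto simp: disjoint_family_on_def)
  also have "\<dots> = (\<Sum>i. c * emeasure M (C i \<inter> E))" by simp
  also have "\<dots> \<le> (\<Sum>i. d * emeasure M (C i))"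
    by (intro suminf_le bound[OF C_sets C_sub]) auto
  also have "\<dots> = d * (\<Sum>i. emeasure M (C i))" by simp
  also have "(\<Sum>i. emeasure M (C i)) = emeasure M (A \<inter> (\<Union>m\<in>{n..}. B m))"
    using disj C_sets_M UN_C by (subst suminf_emeasure) auto
  finally show ?thesis .
qed

definition oscillation :: "ennreal \<Rightarrow> ennreal \<Rightarrow> 'w set" where
  "oscillation a b = {\<omega>\<in>space M. (\<forall>n. \<exists>m\<ge>n. W m \<omega> \<le> a) \<and> (\<forall>n. \<exists>m\<ge>n. b \<le> W m \<omega>)}"

lemma oscillation_sets [measurable]: "oscillation a b \<in> sets M"
  unfolding oscillation_def by measurable

text \<open>
  The constants \<open>a\<close> and \<open>b\<close> are kept on separate sides as powers, which avoids division in
  \<open>[0, \<infinity>]\<close>. One induction step waits for a visit below \<open>a\<close>, then for a visit above \<open>b\<close>, and uses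
  the induction hypothesis from there; the maximal inequality bounds the probability of the second
  visit and provides the additional factor.
\<close>

lemma oscillation_iterated_bound:
  assumes "A \<in> sets (\<F> n)"
  shows "b ^ k * emeasure M (A \<inter> oscillation a b) \<le> a ^ k * emeasure M A"
  using assms
proof (induction k arbitrary: n A)
  case 0
  then show ?case
    using sets_filtration_in_sets by (auto intro!: emeasure_mono)
next
  case (Suc k)
  define Lo where "Lo m = {\<omega>\<in>space M. W m \<omega> \<le> a}" for m
  define Hi where "Hi m = {\<omega>\<in>space M. b \<le> W m \<omega>}" for m
  have Lo: "Lo m \<in> sets (\<F> m)" and Hi: "Hi m \<in> sets (\<F> m)" for m
    unfolding Lo_def Hi_def space_filtration[of m, symmetric]
    using adapted[of m] by measurable
  have osc_Lo: "oscillation a b \<subseteq> (\<Union>m\<in>{n..}. Lo m)"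
    and osc_Hi: "oscillation a b \<subseteq> (\<Union>m\<in>{n..}. Hi m)" for n
    unfolding oscillation_def Lo_def Hi_def by fastforce+
  \<comment> \<open>The claim for events on which the process is below \<open>a\<close>: it only remains to wait for a visit
    above \<open>b\<close>.\<close>
  have from_low: "b ^ Suc k * emeasure M (C \<inter> oscillation a b) \<le> a ^ Suc k * emeasure M C"
    if C: "C \<in> sets (\<F> m)" "C \<subseteq> Lo m" for m C
  proof -
    have [measurable]: "C \<in> sets M" using C sets_filtration_in_sets by blast
    have "b ^ k * emeasure M (C \<inter> oscillation a b)
        \<le> a ^ k * emeasure M (C \<inter> (\<Union>j\<in>{m..}. Hi j))"
    proof (rule first_passage_bound[OF C(1) Hi oscillation_sets osc_Hi])
      show "b ^ k * emeasure M (A \<inter> oscillation a b) \<le> a ^ k * emeasure M A"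
        if "A \<in> sets (\<F> j)" for j A
        using Suc.IH that .
    qed
    then have "b * (b ^ k * emeasure M (C \<inter> oscillation a b))
        \<le> b * (a ^ k * emeasure M (C \<inter> (\<Union>j\<in>{m..}. Hi j)))"
      by (rule mult_left_mono) simp
    also have "\<dots> = a ^ k * (b * emeasure M (C \<inter> (\<Union>j\<in>{m..}. Hi j)))"
      by (simp add: ac_simps)
    also have "b * emeasure M (C \<inter> (\<Union>j\<in>{m..}. Hi j)) \<le> (\<integral>\<^sup>+\<omega>\<in>C. W m \<omega> \<partial>M)"
      unfolding Hi_def by (rule maximal_inequality[OF C(1)])
    also have "(\<integral>\<^sup>+\<omega>\<in>C. W m \<omega> \<partial>M) \<le> (\<integral>\<^sup>+\<omega>. a * indicator C \<omega> \<partial>M)"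
      using C(2) by (intro nn_integral_mono) (auto simp: indicator_def Lo_def)
    also have "\<dots> = a * emeasure M C"
      by (rule nn_integral_cmult_indicator) simp
    finally show ?thesis
      by (simp add: mult_left_mono mult.assoc mult.left_commute[of a])
  qed
  have "b ^ Suc k * emeasure M (A \<inter> oscillation a b)
      \<le> a ^ Suc k * emeasure M (A \<inter> (\<Union>m\<in>{n..}. Lo m))"
    by (rule first_passage_bound[OF Suc.prems Lo oscillation_sets osc_Lo from_low])
  also have "\<dots> \<le> a ^ Suc k * emeasure M A"
    using Suc.prems sets_filtration_in_sets by (intro mult_left_mono emeasure_mono) auto
  finally show ?case .
qed

lemma oscillation_null:
  fixes a b :: real
  assumes "0 \<le> a" "a < b"
  shows "emeasure M (oscillation a b) = 0"
proof -
  let ?p = "prob (oscillation a b)"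
  have bound: "?p \<le> (a / b) ^ k" for k
  proof -
    have "space M \<in> sets (\<F> 0)"
      using sets.top[of "\<F> 0"] by simp
    from oscillation_iterated_bound[OF this, of b k a]
    have "ennreal b ^ k * emeasure M (oscillation a b) \<le> ennreal a ^ k"
      by (simp add: emeasure_space_1)
    then have "ennreal (b ^ k * ?p) \<le> ennreal (a ^ k)"
      using assms by (simp add: emeasure_eq_measure ennreal_power ennreal_mult)
    then have "b ^ k * ?p \<le> a ^ k"
      using assms by (simp add: ennreal_le_iff)
    then show ?thesis
      using assms by (simp add: power_divide field_simps)
  qed
  have "(\<lambda>k. (a / b) ^ k) \<longlonglongrightarrow> 0"
    using assms by (intro LIMSEQ_power_zero) auto
  then have "?p \<le> 0"
    using bound by (intro LIMSEQ_le_const) auto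
  then show ?thesis
    by (simp add: emeasure_eq_measure measure_le_0_iff)
qed

end

lemma ennreal_tendsto_if_no_oscillation:
  fixes u :: "nat \<Rightarrow> ennreal"
  assumes "\<And>a b :: rat. 0 \<le> a \<Longrightarrow> a < b \<Longrightarrow>
    \<not> ((\<forall>n. \<exists>m\<ge>n. u m \<le> real_of_rat a) \<and> (\<forall>n. \<exists>m\<ge>n. real_of_rat b \<le> u m))"
  shows "u \<longlonglongrightarrow> liminf u"
proof -
  have "liminf u = limsup u"
  proof (rule ccontr)
    assume "liminf u \<noteq> limsup u"
    then have "liminf u < limsup u"
      using Liminf_le_Limsup[of sequentially u] by simp
    then obtain b :: rat where b: "liminf u < real_of_rat b" "real_of_rat b < limsup u"
      using ennreal_rat_dense by blast
    obtain a :: rat where a: "liminf u < real_of_rat a" "ennreal (real_of_rat a) < real_of_rat b"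
      using ennreal_rat_dense b(1) by blast
    have a0: "0 \<le> a"
    proof (rule ccontr)
      assume "\<not> 0 \<le> a"
      then have "ennreal (real_of_rat a) = 0"
        by (intro ennreal_neg) simp
      then show False using a(1) by simp
    qed
    have ab: "a < b"
      using a(2) a0 by (auto simp: ennreal_less_iff of_rat_less)
    have "\<exists>m\<ge>n. u m \<le> real_of_rat a" for n
    proof (rule ccontr)
      assume "\<not> ?thesis"
      then have "eventually (\<lambda>m. real_of_rat a \<le> u m) sequentially"
        unfolding eventually_sequentially by (meson linear)
      from Liminf_bounded[OF this] show False using a(1) by simp
    qed
    moreover have "\<exists>m\<ge>n. real_of_rat b \<le> u m" for n
    proof (rule ccontr)
      assume "\<not> ?thesis"
      then have "eventually (\<lambda>m. u m \<le> real_of_rat b) sequentially"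
        unfolding eventually_sequentially by (meson linear)
      from Limsup_bounded[OF this] show False using b(2) by simp
    qed
    ultimately show False
      using assms[OF a0 ab] by blast
  qed
  then show ?thesis
    by (simp add: tendsto_iff_Liminf_eq_Limsup)
qed

context nonneg_supermartingale
begin

text \<open>
  The limit exists because rational levels suffice to detect an oscillation. It is finite by Fatou's
  lemma, as the expectations decrease.
\<close>

theorem Doob_convergence:
  assumes "(\<integral>\<^sup>+\<omega>. W 0 \<omega> \<partial>M) < \<infinity>"
  shows "AE \<omega> in M. (\<lambda>n. W n \<omega>) \<longlonglongrightarrow> liminf (\<lambda>n. W n \<omega>) \<and> liminf (\<lambda>n. W n \<omega>) < \<infinity>"
proof -
  have mono: "(\<integral>\<^sup>+\<omega>. W n \<omega> \<partial>M) \<le> (\<integral>\<^sup>+\<omega>. W 0 \<omega> \<partial>M)" for n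
  proof (induction n)
    case (Suc n)
    have "space M \<in> sets (\<F> n)"
      using sets.top[of "\<F> n"] by simp
    from set_integral_decreasing[OF this]
    have "(\<integral>\<^sup>+\<omega>. W (Suc n) \<omega> \<partial>M) \<le> (\<integral>\<^sup>+\<omega>. W n \<omega> \<partial>M)"
      by (simp add: nn_set_integral_space)
    with Suc show ?case by simp
  qed simp
  have "(\<integral>\<^sup>+\<omega>. liminf (\<lambda>n. W n \<omega>) \<partial>M) \<le> liminf (\<lambda>n. \<integral>\<^sup>+\<omega>. W n \<omega> \<partial>M)"
    by (rule nn_integral_liminf) simp
  also have "\<dots> \<le> liminf (\<lambda>n::nat. \<integral>\<^sup>+\<omega>. W 0 \<omega> \<partial>M)"
    by (intro Liminf_mono always_eventually allI mono)
  also have "\<dots> < \<infinity>" using assms by (simp add: Liminf_const)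
  finally have "AE \<omega> in M. liminf (\<lambda>n. W n \<omega>) \<noteq> \<infinity>"
    by (intro nn_integral_noteq_infinite) auto
  moreover have "AE \<omega> in M. \<forall>a b :: rat. 0 \<le> a \<and> a < b \<longrightarrow>
      \<omega> \<notin> oscillation (real_of_rat a) (real_of_rat b)"
    unfolding AE_all_countable
    by (auto intro!: AE_not_in null_setsI oscillation_null simp: of_rat_less)
  ultimately show ?thesis
    using AE_space
  proof eventually_elim
    case (elim \<omega>)
    have "(\<lambda>n. W n \<omega>) \<longlonglongrightarrow> liminf (\<lambda>n. W n \<omega>)"
      using elim(2,3) by (intro ennreal_tendsto_if_no_oscillation) (auto simp: oscillation_def)
    with elim(1) show ?case by (simp add: less_top)
  qed
qed

end

section \<open>The Robbins--Siegmund theorem\<close>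

text \<open>
  Dividing by the products \<open>P\<^sub>n = \<Prod>\<^bsub>j<n\<^esub> (1 + \<gamma>\<^sub>j)\<close> removes the factors \<open>1 + \<gamma>\<^sub>n\<close>, and subtracting the
  partial sums \<open>S\<^sub>n\<close> of the errors \<open>\<eta>\<^sub>j\<close> compensates for the errors. The result \<open>V\<^sub>n / P\<^sub>n - S\<^sub>n\<close> has no
  lower bound, since the sum of the errors is finite but need be neither bounded nor integrable. Therefore a
  constant \<open>C\<close> is added and the process is killed as soon as \<open>S\<^sub>n > C\<close>. Since \<open>S\<^bsub>n+1\<^esub>\<close> is known at
  time \<open>n\<close>, killing preserves the supermartingale property and keeps the process nonnegative. On the
  event that the errors sum up to at most \<open>C\<close> nothing is killed, and these events exhaust almost the
  whole space as \<open>C\<close> runs through the natural numbers.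
\<close>

lemma Robbins_Siegmund:
  fixes V \<eta> \<gamma> :: "nat \<Rightarrow> 'w \<Rightarrow> real"
  assumes "prob_space M"
    and filtration: "filtration_of M \<F>"
    and V_adapted: "adapted_to \<F> V"
    and V_nonneg: "\<And>n \<omega>. \<omega> \<in> space M \<Longrightarrow> 0 \<le> V n \<omega>"
    and V_0: "integrable M (V 0)"
    and \<eta>: "\<eta> \<in> l1_plus M \<F>" and \<gamma>: "\<gamma> \<in> l1_plus M \<F>"
    and recursion: "\<And>n. AE \<omega> in M. nn_cond_exp M (\<F> n) (\<lambda>\<omega>. ennreal (V (Suc n) \<omega>)) \<omega>
      \<le> ennreal ((1 + \<gamma> n \<omega>) * V n \<omega> + \<eta> n \<omega>)"
  shows "AE \<omega> in M. convergent (\<lambda>n. V n \<omega>)"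
proof -
  interpret prob_space M by fact
  define S where "S n \<omega> = (\<Sum>j<n. \<eta> j \<omega>)" for n \<omega>
  define P where "P n \<omega> = (\<Prod>j<n. 1 + \<gamma> j \<omega>)" for n \<omega>
  define W where "W C n \<omega> =
    ennreal (if S n \<omega> \<le> C then V n \<omega> / P n \<omega> + (C - S n \<omega>) else 0)" for C n \<omega>
  have subalg: "subalgebra M (\<F> n)" for n
    using filtration by (simp add: filtration_of_def)
  have space_eq [simp]: "space (\<F> n) = space M" for n
    using subalg[of n] by (simp add: subalgebra_def)
  have subalg_mono: "subalgebra (\<F> n) (\<F> m)" if "m \<le> n" for m n
    using filtration that by (auto simp: subalgebra_def filtration_of_def filtration_def)
  have \<eta>_nonneg: "0 \<le> \<eta> n \<omega>" and \<gamma>_nonneg: "0 \<le> \<gamma> n \<omega>" if "\<omega> \<in> space M" for n \<omega>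
    using \<eta> \<gamma> that by (auto simp: l1_plus_def)
  have P_ge_1: "1 \<le> P n \<omega>" if "\<omega> \<in> space M" for n \<omega>
    unfolding P_def using \<gamma>_nonneg[OF that] by (intro prod_ge_1) auto
  have S_meas: "S (Suc n) \<in> borel_measurable (\<F> n)" and P_meas: "P (Suc n) \<in> borel_measurable (\<F> n)" for n
  proof -
    have "\<eta> j \<in> borel_measurable (\<F> n)" "\<gamma> j \<in> borel_measurable (\<F> n)" if "j < Suc n" for j
      using \<eta> \<gamma> that by (auto simp: l1_plus_def adapted_to_def
          intro!: measurable_from_subalg[OF subalg_mono[of j n]])
    then show "S (Suc n) \<in> borel_measurable (\<F> n)" "P (Suc n) \<in> borel_measurable (\<F> n)"
      unfolding S_def P_def by (auto intro!: borel_measurable_sum borel_measurable_prod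
          borel_measurable_add)
  qed
  have S_meas': "S n \<in> borel_measurable (\<F> n)" and P_meas': "P n \<in> borel_measurable (\<F> n)" for n
  proof -
    have "S 0 = (\<lambda>\<omega>. 0)" "P 0 = (\<lambda>\<omega>. 1)"
      by (simp_all add: S_def P_def fun_eq_iff)
    then show "S n \<in> borel_measurable (\<F> n)" "P n \<in> borel_measurable (\<F> n)"
      by (cases n; auto intro!: measurable_from_subalg[OF subalg_mono S_meas]
          measurable_from_subalg[OF subalg_mono P_meas])+
  qed
  have V_meas: "V n \<in> borel_measurable (\<F> n)" for n
    using V_adapted by (simp add: adapted_to_def)
  have V_meas_M [measurable]: "V n \<in> borel_measurable M" for n
    using measurable_from_subalg[OF subalg V_meas] .

  have W_supermartingale: "nonneg_supermartingale M \<F> (W C)" for C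
  proof
    show "filtration_of M \<F>" by fact
    show "W C n \<in> borel_measurable (\<F> n)" for n
      using S_meas'[of n] P_meas'[of n] V_meas[of n] unfolding W_def by measurable
  next
    fix n A assume A: "A \<in> sets (\<F> n)"
    \<comment> \<open>On \<open>A\<close> the next value of the process is affine in \<open>V\<^bsub>n+1\<^esub>\<close>, with nonnegative coefficients
      \<open>f\<close> and \<open>g\<close> which are known at time \<open>n\<close>; so \<open>V\<^bsub>n+1\<^esub>\<close> may be replaced by its conditional
      expectation.\<close>
    define f where "f \<omega> = indicator A \<omega> *
      ennreal (if S (Suc n) \<omega> \<le> C then 1 / P (Suc n) \<omega> else 0)" for \<omega>
    define g where "g \<omega> = indicator A \<omega> *
      ennreal (if S (Suc n) \<omega> \<le> C then C - S (Suc n) \<omega> else 0)" for \<omega>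
    have f_meas: "f \<in> borel_measurable (\<F> n)" and g_meas: "g \<in> borel_measurable (\<F> n)"
      using A S_meas[of n] P_meas[of n] unfolding f_def g_def by measurable
    have [measurable]: "f \<in> borel_measurable M" "g \<in> borel_measurable M"
      using measurable_from_subalg[OF subalg] f_meas g_meas by blast+
    interpret finite_measure_subalgebra M "\<F> n"
      by unfold_locales (rule subalg)
    have "(\<integral>\<^sup>+\<omega>\<in>A. W C (Suc n) \<omega> \<partial>M) = (\<integral>\<^sup>+\<omega>. f \<omega> * ennreal (V (Suc n) \<omega>) + g \<omega> \<partial>M)"
    proof (rule nn_integral_cong)
      fix \<omega> assume "\<omega> \<in> space M"
      then show "W C (Suc n) \<omega> * indicator A \<omega> = f \<omega> * ennreal (V (Suc n) \<omega>) + g \<omega>"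
        using V_nonneg[of \<omega> "Suc n"] P_ge_1[of \<omega> "Suc n"]
        by (auto simp: W_def f_def g_def indicator_def ennreal_plus[symmetric]
            ennreal_mult[symmetric] simp del: ennreal_plus)
    qed
    also have "\<dots> = (\<integral>\<^sup>+\<omega>. f \<omega> * ennreal (V (Suc n) \<omega>) \<partial>M) + (\<integral>\<^sup>+\<omega>. g \<omega> \<partial>M)"
      by (rule nn_integral_add) auto
    also have "(\<integral>\<^sup>+\<omega>. f \<omega> * ennreal (V (Suc n) \<omega>) \<partial>M)
        = (\<integral>\<^sup>+\<omega>. f \<omega> * nn_cond_exp M (\<F> n) (\<lambda>\<omega>. ennreal (V (Suc n) \<omega>)) \<omega> \<partial>M)"
      by (rule nn_cond_exp_intg[symmetric]) (auto intro: f_meas)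
    also have "\<dots> + (\<integral>\<^sup>+\<omega>. g \<omega> \<partial>M)
        = (\<integral>\<^sup>+\<omega>. f \<omega> * nn_cond_exp M (\<F> n) (\<lambda>\<omega>. ennreal (V (Suc n) \<omega>)) \<omega> + g \<omega> \<partial>M)"
      by (rule nn_integral_add[symmetric]) auto
    also have "\<dots> \<le> (\<integral>\<^sup>+\<omega>\<in>A. W C n \<omega> \<partial>M)"
    proof (rule nn_integral_mono_AE)
      show "AE \<omega> in M. f \<omega> * nn_cond_exp M (\<F> n) (\<lambda>\<omega>. ennreal (V (Suc n) \<omega>)) \<omega> + g \<omega>
          \<le> W C n \<omega> * indicator A \<omega>"
        using recursion[of n] AE_space
      proof eventually_elim
        case (elim \<omega>)
        note nonneg = \<eta>_nonneg[OF elim(2), of n] \<gamma>_nonneg[OF elim(2), of n] V_nonneg[OF elim(2), of n]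
        have Pn: "1 \<le> P n \<omega>" by (rule P_ge_1[OF elim(2)])
        have P_Suc: "P (Suc n) \<omega> = P n \<omega> * (1 + \<gamma> n \<omega>)" and S_Suc: "S (Suc n) \<omega> = S n \<omega> + \<eta> n \<omega>"
          by (simp_all add: P_def S_def)
        show ?case
        proof (cases "\<omega> \<in> A \<and> S (Suc n) \<omega> \<le> C")
          case True
          have P_Suc_ge: "1 \<le> P (Suc n) \<omega>" by (rule P_ge_1[OF elim(2)])
          have "f \<omega> * nn_cond_exp M (\<F> n) (\<lambda>\<omega>. ennreal (V (Suc n) \<omega>)) \<omega> + g \<omega>
              \<le> ennreal (1 / P (Suc n) \<omega>) * ennreal ((1 + \<gamma> n \<omega>) * V n \<omega> + \<eta> n \<omega>)
                + ennreal (C - S (Suc n) \<omega>)"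
            using True elim(1) by (auto simp: f_def g_def intro!: add_mono mult_left_mono)
          also have "\<dots> = ennreal (V n \<omega> / P n \<omega> + \<eta> n \<omega> / P (Suc n) \<omega> + (C - S (Suc n) \<omega>))"
          proof -
            have "1 / P (Suc n) \<omega> * ((1 + \<gamma> n \<omega>) * V n \<omega> + \<eta> n \<omega>)
                = V n \<omega> / P n \<omega> + \<eta> n \<omega> / P (Suc n) \<omega>"
              using Pn nonneg by (simp add: P_Suc add_divide_distrib)
            then show ?thesis
              using True nonneg Pn P_Suc_ge
              by (subst ennreal_mult[symmetric]) (auto simp flip: ennreal_plus)
          qed
          also have "\<dots> \<le> ennreal (V n \<omega> / P n \<omega> + (C - S n \<omega>))"
          proof (rule ennreal_leI)
            have "\<eta> n \<omega> / P (Suc n) \<omega> \<le> \<eta> n \<omega>"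
              using nonneg P_Suc_ge by (simp add: divide_le_eq mult_le_cancel_left1)
            then show "V n \<omega> / P n \<omega> + \<eta> n \<omega> / P (Suc n) \<omega> + (C - S (Suc n) \<omega>)
                \<le> V n \<omega> / P n \<omega> + (C - S n \<omega>)"
              by (simp add: S_Suc)
          qed
          also have "\<dots> = W C n \<omega> * indicator A \<omega>"
            using True nonneg by (simp add: W_def S_Suc)
          finally show ?thesis .
        qed (auto simp: f_def g_def)
      qed
    qed
    finally show "(\<integral>\<^sup>+\<omega>\<in>A. W C (Suc n) \<omega> \<partial>M) \<le> (\<integral>\<^sup>+\<omega>\<in>A. W C n \<omega> \<partial>M)" .
  qed

  have W_conv: "AE \<omega> in M. \<forall>C::nat. (\<lambda>n. W C n \<omega>) \<longlonglongrightarrow> liminf (\<lambda>n. W C n \<omega>)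
      \<and> liminf (\<lambda>n. W C n \<omega>) < \<infinity>"
    unfolding AE_all_countable
  proof
    fix C :: nat
    interpret W: nonneg_supermartingale M \<F> "W C" by (rule W_supermartingale)
    have "(\<integral>\<^sup>+\<omega>. W C 0 \<omega> \<partial>M) = (\<integral>\<^sup>+\<omega>. ennreal (V 0 \<omega> + C) \<partial>M)"
      by (simp add: W_def S_def P_def)
    also have "\<dots> < \<infinity>"
    proof -
      have "integrable M (\<lambda>\<omega>. V 0 \<omega> + C)" using V_0 by simp
      moreover have "AE \<omega> in M. 0 \<le> V 0 \<omega> + C"
        using V_nonneg by (auto intro!: AE_I2 add_nonneg_nonneg)
      ultimately show ?thesis
        by (simp add: nn_integral_eq_integral)
    qed
    finally show "AE \<omega> in M. (\<lambda>n. W C n \<omega>) \<longlonglongrightarrow> liminf (\<lambda>n. W C n \<omega>) \<and> liminf (\<lambda>n. W C n \<omega>) < \<infinity>"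
      by (rule W.Doob_convergence)
  qed
  have "AE \<omega> in M. summable (\<lambda>n. \<eta> n \<omega>)" "AE \<omega> in M. summable (\<lambda>n. \<gamma> n \<omega>)"
    using \<eta> \<gamma> by (auto simp: l1_plus_def)
  then show ?thesis
    using W_conv AE_space
  proof eventually_elim
    case (elim \<omega>)
    note nonneg = \<eta>_nonneg[OF elim(4)] \<gamma>_nonneg[OF elim(4)] V_nonneg[OF elim(4)]
    have Pn: "1 \<le> P n \<omega>" for n by (rule P_ge_1[OF elim(4)])
    obtain C :: nat where "(\<Sum>n. \<eta> n \<omega>) \<le> C"
      using real_arch_simple by blast
    moreover have "S n \<omega> \<le> (\<Sum>n. \<eta> n \<omega>)" for n
      unfolding S_def using elim(1) nonneg by (intro sum_le_suminf) auto
    ultimately have S_le: "S n \<omega> \<le> C" for n by (rule order_trans[rotated])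
    define w where "w n = V n \<omega> / P n \<omega> + (C - S n \<omega>)" for n
    have w_nonneg: "0 \<le> w n" for n
      using S_le nonneg Pn[of n] by (simp add: w_def)
    have "convergent w"
    proof -
      have "(\<lambda>n. ennreal (w n)) \<longlonglongrightarrow> liminf (\<lambda>n. W C n \<omega>)"
        using spec[OF elim(3), of C] S_le by (simp add: W_def w_def)
      moreover obtain l where "0 \<le> l" "liminf (\<lambda>n. W C n \<omega>) = ennreal l"
        using spec[OF elim(3), of C] by (cases "liminf (\<lambda>n. W C n \<omega>)") auto
      ultimately have "w \<longlonglongrightarrow> l"
        using w_nonneg by (simp add: tendsto_ennreal_iff)
      then show ?thesis by (rule convergentI)
    qed
    moreover have "convergent (\<lambda>n. S n \<omega>)"
      using elim(1) by (simp add: S_def summable_iff_convergent)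
    moreover have "convergent (\<lambda>n. P n \<omega>)"
    proof (rule Bseq_monoseq_convergent)
      show "Bseq (\<lambda>n. P n \<omega>)"
      proof (rule BseqI')
        fix n
        have "P n \<omega> \<le> exp (\<Sum>j<n. \<gamma> j \<omega>)"
          unfolding P_def by (rule prod_le_exp_sum) (rule nonneg)
        also have "\<dots> \<le> exp (\<Sum>j. \<gamma> j \<omega>)"
          using elim(2) nonneg by (simp add: sum_le_suminf)
        finally show "norm (P n \<omega>) \<le> exp (\<Sum>j. \<gamma> j \<omega>)"
          using Pn[of n] by simp
      qed
      show "monoseq (\<lambda>n. P n \<omega>)"
      proof (intro mono_SucI1 allI)
        fix n
        show "P n \<omega> \<le> P (Suc n) \<omega>"
          using Pn[of n] nonneg(2)[of n] by (simp add: P_def mult_le_cancel_left1)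
      qed
    qed
    \<comment> \<open>Undo the transformation from \<open>V\<close> to \<open>w\<close>.\<close>
    ultimately have "convergent (\<lambda>n. P n \<omega> * (w n + S n \<omega> - C))"
      by (intro convergent_mult convergent_diff convergent_add convergent_const)
    moreover have "P n \<omega> * (w n + S n \<omega> - C) = V n \<omega>" for n
      using Pn[of n] by (simp add: w_def)
    ultimately show ?case by simp
  qed
qed

section \<open>Deterministic convergence\<close>

text \<open>
  The limit \<open>L\<close> of \<open>G (u\<^sub>n)\<close> is a value \<open>G t\<close> by the intermediate value theorem; here coercivity
  prevents \<open>L\<close> from being approached only as \<open>u\<^sub>n\<close> tends to infinity. Strict monotonicity then turns
  bounds on \<open>G (u\<^sub>n)\<close> into bounds on \<open>u\<^sub>n\<close>.
\<close>

lemma convergent_if_convergent_strict_mono: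
  fixes G :: "real \<Rightarrow> real"
  assumes mono: "strict_mono_on {0..} G" and cont: "continuous_on {0..} G"
    and coercive: "filterlim G at_top at_top"
    and u: "\<And>n. 0 \<le> u n" and conv: "convergent (\<lambda>n. G (u n))"
  shows "convergent u"
proof -
  obtain L where L: "(\<lambda>n. G (u n)) \<longlonglongrightarrow> L" using conv by (auto simp: convergent_def)
  have G_less: "G s < G t \<longleftrightarrow> s < t" if "0 \<le> s" "0 \<le> t" for s t
    using strict_mono_on_less[OF mono] that by simp
  have G_0: "G 0 \<le> L"
    using L u strict_mono_on_leD[OF mono] by (intro LIMSEQ_le_const) auto
  obtain T where T: "0 \<le> T" "L \<le> G T"
  proof -
    have "eventually (\<lambda>t. L \<le> G t \<and> 0 \<le> t) at_top"
      using coercive eventually_ge_at_top[of 0]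
      by (auto simp: filterlim_at_top eventually_conj_iff)
    then show ?thesis
      using that eventually_happens'[OF trivial_limit_at_top_linorder] by blast
  qed
  obtain t where t: "0 \<le> t" "G t = L"
    using IVT'[OF G_0 T(2) T(1) continuous_on_subset[OF cont]] by auto
  have "u \<longlonglongrightarrow> t"
  proof (rule order_tendstoI)
    fix a assume a: "a < t"
    show "eventually (\<lambda>n. a < u n) sequentially"
    proof (cases "a < 0")
      case True
      then have "a < u n" for n using u[of n] by simp
      then show ?thesis by simp
    next
      case False
      then have "G a < L" using G_less[of a t] a t by simp
      from order_tendstoD(1)[OF L this] show ?thesis
        using G_less[of a] False u by simp
    qed
  next
    fix a assume a: "t < a"
    then have "L < G a" using G_less[of t a] t by simp
    from order_tendstoD(2)[OF L this] show "eventually (\<lambda>n. u n < a) sequentially"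
      using G_less[of _ a] a t u by simp
  qed
  then show ?thesis by (rule convergentI)
qed

text \<open>
  A cluster point \<open>p \<in> F\<close> comes from compactness and explicit closedness. As \<open>p\<close> need
  not belong to \<open>Z\<close>, the distances are taken to a nearby \<open>z \<in> Z\<close>: they converge, and the subsequence
  tending to \<open>p\<close> identifies their limit as the small number \<open>d (p, z)\<close>.
\<close>

lemma tendsto_member_if_distances_converge:
  fixes x :: "nat \<Rightarrow> 'a::metric_space"
  assumes "compact X0" and AF: "\<And>k. AF (Suc k) \<subseteq> AF k" "\<And>k. AF k \<subseteq> X0"
    and closed: "explicitly_closed F AF"
    and visits: "\<And>k N. \<exists>n\<ge>N. x n \<in> AF k"
    and dense: "F \<subseteq> closure Z"
    and conv: "\<And>z. z \<in> Z \<Longrightarrow> convergent (\<lambda>n. dist (x n) z)"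
  shows "\<exists>p\<in>F. x \<longlonglongrightarrow> p"
proof -
  have AF_antimono: "AF n \<subseteq> AF m" if "m \<le> n" for m n
    using lift_Suc_antimono_le[of AF, OF AF(1) that] .
  have "\<forall>k. \<exists>n. k \<le> n \<and> x n \<in> AF k" using visits by blast
  from choice[OF this] obtain n where n: "\<And>k. k \<le> n k" "\<And>k. x (n k) \<in> AF k"
    by blast
  have "\<forall>k. x (n k) \<in> X0" using n(2) AF(2) by blast
  then obtain p r where r: "strict_mono r" and p: "(\<lambda>k. x (n (r k))) \<longlonglongrightarrow> p"
    using seq_compactE[OF compact_imp_seq_compact[OF \<open>compact X0\<close>], of "\<lambda>k. x (n k)"]
    unfolding comp_def by blast
  have "p \<in> F"
    using closed unfolding explicitly_closed_def
  proof (elim allE impE)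
    show "\<forall>N m. AF m \<inter> cball p (1 / (real N + 1)) \<noteq> {}"
    proof (intro allI)
      fix N m :: nat
      have "eventually (\<lambda>k. dist (x (n (r k))) p < 1 / (real N + 1)) sequentially"
        by (intro tendstoD[OF p]) simp
      then have "eventually (\<lambda>k. dist (x (n (r k))) p < 1 / (real N + 1) \<and> m \<le> k) sequentially"
        using eventually_ge_at_top by (rule eventually_conj)
      then obtain k where k: "dist (x (n (r k))) p < 1 / (real N + 1)" "m \<le> k"
        using eventually_happens'[OF sequentially_bot] by blast
      have "m \<le> r k" using k(2) seq_suble[OF r] order_trans by blast
      then have "x (n (r k)) \<in> AF m" using n(2) AF_antimono by blast
      then show "AF m \<inter> cball p (1 / (real N + 1)) \<noteq> {}"
        using k(1) by (auto simp: dist_commute)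
    qed
  qed
  have "x \<longlonglongrightarrow> p"
  proof (rule tendstoI)
    fix e :: real assume "0 < e"
    then have "0 < e / 2" by simp
    then obtain z where z: "z \<in> Z" "dist z p < e / 2"
      using \<open>p \<in> F\<close> dense by (meson closure_approachable subsetD)
    obtain l where l: "(\<lambda>n. dist (x n) z) \<longlonglongrightarrow> l"
      using conv[OF z(1)] by (auto simp: convergent_def)
    have "filterlim (\<lambda>k. n (r k)) sequentially sequentially"
      using n(1) seq_suble[OF r]
      by (intro filterlim_at_top_mono[OF filterlim_ident] always_eventually) (meson order_trans)
    from filterlim_compose[OF l this] have "(\<lambda>k. dist (x (n (r k))) z) \<longlonglongrightarrow> l" .
    moreover have "(\<lambda>k. dist (x (n (r k))) z) \<longlonglongrightarrow> dist p z"
      by (intro tendsto_dist p tendsto_const)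
    ultimately have "l < e / 2"
      using z(2) LIMSEQ_unique by (fastforce simp: dist_commute)
    from order_tendstoD(2)[OF l this]
    show "eventually (\<lambda>n. dist (x n) p < e) sequentially"
    proof eventually_elim
      case (elim n)
      then show ?case using z(2) dist_triangle[of "x n" p z] by simp
    qed
  qed
  with \<open>p \<in> F\<close> show ?thesis by blast
qed

section \<open>Convergence of the stochastic iteration\<close>

text \<open>
  The bound on \<open>d (z, p\<^sub>0)\<close> serves to dominate the initial value \<open>G (d (x\<^sub>0, z))\<close> by the integrable
  \<open>G (d (x\<^sub>0, p\<^sub>0) + D)\<close>.
\<close>

lemma quasi_Fejer_distances_converge:
  fixes x :: "nat \<Rightarrow> 'w \<Rightarrow> 'a::polish_space"
  assumes "prob_space M" and "filtration_of M \<F>"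
    and mono: "strict_mono_on {0..} G" and cont: "continuous_on {0..} G"
    and coercive: "filterlim G at_top at_top" and G_0: "G 0 = 0"
    and Fejer: "stoch_quasi_Fejer M \<F> G F x"
    and z: "z \<in> F" "dist z p0 \<le> D"
    and integrable: "integrable M (\<lambda>\<omega>. G (dist (x 0 \<omega>) p0 + D))"
  shows "AE \<omega> in M. convergent (\<lambda>n. dist (x n \<omega>) z)"
proof -
  have G_le: "G s \<le> G t" if "0 \<le> s" "s \<le> t" for s t
    using strict_mono_on_leD[OF mono] that by simp
  have G_nonneg: "0 \<le> G t" if "0 \<le> t" for t
    using G_le[of 0 t] G_0 that by simp
  have adapted: "adapted_to \<F> (\<lambda>n \<omega>. G (dist (x n \<omega>) z))"
    unfolding adapted_to_def
  proof
    fix n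
    have [measurable]: "x n \<in> borel_measurable (\<F> n)"
      using Fejer by (simp add: stoch_quasi_Fejer_def adapted_to_def)
    \<comment> \<open>Continuity of \<open>G\<close> is known on the nonnegative reals only, so \<open>G\<close> is extended
      constantly.\<close>
    have "continuous_on UNIV (\<lambda>t. G (max 0 t))"
      by (rule continuous_on_compose2[OF cont]) (auto intro!: continuous_intros)
    then have [measurable]: "(\<lambda>t. G (max 0 t)) \<in> borel_measurable borel"
      by (rule borel_measurable_continuous_onI)
    have "(\<lambda>\<omega>. G (max 0 (dist (x n \<omega>) z))) \<in> borel_measurable (\<F> n)"
      by measurable
    then show "(\<lambda>\<omega>. G (dist (x n \<omega>) z)) \<in> borel_measurable (\<F> n)" by simp
  qed
  have "(\<lambda>\<omega>. G (dist (x 0 \<omega>) z)) \<in> borel_measurable M"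
    using adapted assms(2) measurable_from_subalg
    unfolding adapted_to_def filtration_of_def by blast
  moreover have "G (dist (x 0 \<omega>) z) \<le> G (dist (x 0 \<omega>) p0 + D)" for \<omega>
    using z(2) dist_triangle[of "x 0 \<omega>" z p0] by (intro G_le) (auto simp: dist_commute)
  ultimately have "integrable M (\<lambda>\<omega>. G (dist (x 0 \<omega>) z))"
    using G_nonneg by (intro Bochner_Integration.integrable_bound[OF integrable])
      (auto intro!: AE_I2 order_trans[OF _ abs_ge_self])
  then have "AE \<omega> in M. convergent (\<lambda>n. G (dist (x n \<omega>) z))"
    using Fejer z(1) adapted G_nonneg unfolding stoch_quasi_Fejer_def
    by (blast intro: Robbins_Siegmund[OF assms(1,2), where V="\<lambda>n \<omega>. G (dist (x n \<omega>) z)"] zero_le_dist)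
  then show ?thesis
  proof eventually_elim
    case (elim \<omega>)
    then show ?case
      by (rule convergent_if_convergent_strict_mono[OF mono cont coercive, rotated]) simp
  qed
qed

text \<open>
  Almost sure limits are measurable after a modification on a null set: the sequence is made constant
  there, so that it converges at every point of the space.
\<close>

lemma measurable_limit_if_AE_convergent:
  fixes x :: "nat \<Rightarrow> 'w \<Rightarrow> 'a::metric_space"
  assumes x: "\<And>n. x n \<in> borel_measurable M"
    and lim: "AE \<omega> in M. \<exists>p\<in>F. (\<lambda>n. x n \<omega>) \<longlonglongrightarrow> p"
  shows "\<exists>y. y \<in> borel_measurable M \<and>
           (AE \<omega> in M. (\<lambda>n. x n \<omega>) \<longlonglongrightarrow> y \<omega>) \<and> (AE \<omega> in M. y \<omega> \<in> F)"
proof -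
  obtain N where conv: "\<And>\<omega>. \<omega> \<in> space M - N \<Longrightarrow> \<exists>p\<in>F. (\<lambda>n. x n \<omega>) \<longlonglongrightarrow> p"
    and N: "N \<in> null_sets M"
    by (rule AE_E3[OF lim]) (rule that)
  fix c :: 'a
  define y where "y \<omega> = (if \<omega> \<in> N then c else lim (\<lambda>n. x n \<omega>))" for \<omega>
  have y: "(\<lambda>n. x n \<omega>) \<longlonglongrightarrow> y \<omega> \<and> y \<omega> \<in> F" if "\<omega> \<in> space M - N" for \<omega>
    using conv[OF that] that limI by (fastforce simp: y_def)
  have y_meas: "y \<in> borel_measurable M"
  proof (rule borel_measurable_LIMSEQ_metric)
    show "(\<lambda>\<omega>. if \<omega> \<in> N then c else x n \<omega>) \<in> borel_measurable M" for n
      using x null_setsD2[OF N] by measurable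
    show "(\<lambda>n. if \<omega> \<in> N then c else x n \<omega>) \<longlonglongrightarrow> y \<omega>" if "\<omega> \<in> space M" for \<omega>
      using y[of \<omega>] that by (cases "\<omega> \<in> N") (auto simp: y_def)
  qed
  have "AE \<omega> in M. \<omega> \<in> space M - N"
    using AE_not_in[OF N] AE_space by eventually_elim simp
  then have "AE \<omega> in M. (\<lambda>n. x n \<omega>) \<longlonglongrightarrow> y \<omega> \<and> y \<omega> \<in> F"
    by (rule eventually_mono) (rule y)
  with y_meas show ?thesis by (intro exI[of _ y]) (simp add: AE_conj_iff)
qed

theorem theorem4p22:
  fixes M :: "'w measure"
    and \<F> :: "nat \<Rightarrow> 'w measure"
    and p0 :: "'a::polish_space"
    and X0 F :: "'a set"
    and D :: real
    and AF :: "nat \<Rightarrow> 'a set"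
    and G :: "real \<Rightarrow> real"
    and x :: "nat \<Rightarrow> 'w \<Rightarrow> 'a"
  assumes "prob_space M"
    and "compact X0"
    and "\<forall>z\<in>X0. dist z p0 \<le> D"
    and "F = (\<Inter>k. AF k)" and "F \<noteq> {}"
    and "\<forall>k. AF k \<in> sets borel"
    and "\<forall>k. AF (Suc k) \<subseteq> AF k \<and> AF k \<subseteq> X0"
    and "explicitly_closed F AF"
    and "\<forall>t\<ge>0. G t \<ge> 0"
    and "strict_mono_on {0..} G"
    and "continuous_on {0..} G"
    and "filterlim G at_top at_top"
    and "G 0 = 0"
    and "filtration_of M \<F>"
    and "\<forall>n. x n \<in> borel_measurable M"
    and "stoch_quasi_Fejer M \<F> G F x"
    and "stoch_liminf_property M AF x"
    and "integrable M (\<lambda>\<omega>. G (dist (x 0 \<omega>) p0 + D))"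
  shows "\<exists>y. y \<in> borel_measurable M \<and>
           (AE \<omega> in M. (\<lambda>n. x n \<omega>) \<longlonglongrightarrow> y \<omega>) \<and>
           (AE \<omega> in M. y \<omega> \<in> F)"
proof -
  obtain Z where Z: "countable Z" "Z \<subseteq> F" "F \<subseteq> closure Z"
    using separable by blast
  have "AE \<omega> in M. \<forall>z\<in>Z. convergent (\<lambda>n. dist (x n \<omega>) z)"
    unfolding AE_ball_countable[OF Z(1)]
  proof
    fix z assume "z \<in> Z"
    then have "z \<in> F" "dist z p0 \<le> D"
      using Z(2) assms(3,4,7) by blast+
    then show "AE \<omega> in M. convergent (\<lambda>n. dist (x n \<omega>) z)"
      by (rule quasi_Fejer_distances_converge[OF assms(1,14,10-13,16) _ _ assms(18)])
  qed
  moreover have "AE \<omega> in M. \<forall>k N. \<exists>n\<ge>N. x n \<omega> \<in> AF k"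
    using assms(17) by (simp add: stoch_liminf_property_def)
  ultimately have "AE \<omega> in M. \<exists>p\<in>F. (\<lambda>n. x n \<omega>) \<longlonglongrightarrow> p"
  proof eventually_elim
    case (elim \<omega>)
    then show ?case
      using assms(7) by (intro tendsto_member_if_distances_converge[OF assms(2) _ _ assms(8) _ Z(3)]) auto
  qed
  with assms(15) show ?thesis
    by (intro measurable_limit_if_AE_convergent) auto
qed

end
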